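(* Let $\mathbb{F}$ be a field and let $(f_n)$ be a family of polynomials over $\mathbb{F}$. Then $(f_n)\in \mathsf{VP}$ if and only if there is a polynomial $p$ and a family $(G_n)$ of stack branching programs such that $G_n$ computes $f_n$ and has size at most $p(n)$ for every $n$.
   Context: An arithmetic circuit over $\mathbb{F}$ is a directed acyclic graph whose gates have fanin $0$ (inputs, labeled by constants of $\mathbb{F}$ or variables $X_1,X_2,\dots$) or fanin $2$ (labeled $+$ or $\times$), with a single output gate; it computes a polynomial in the obvious way; its size is its number of gates. $\mathsf{VP}$ is the class of polynomial families $(f_n)$ such that $\deg f_n$ is bounded by a polynomial in $n$ and $f_n$ is computed by arithmetic circuits of size polynomial in $n$. Stack branching programs (SBPs): Let $S$ be a finite symbol set. Stack operations are $\mathrm{push}(s)$, $\mathrm{pop}(s)$ for $s\in S$, and $\mathrm{nop}$. Realizable sequences of stack operations are defined inductively: the empty sequence is realizable; if $P$ is realizable then $\mathrm{push}(s)P\,\mathrm{pop}(s)$ (for any $s\in S$), $\mathrm{nop}\,P$ and $P\,\mathrm{nop}$ are realizable; if $P,Q$ are realizable then $PQ$ is realizable. An SBP is a directed acyclic graph with two distinguished vertices $s,t$, an edge weight labeling $w:E\to\mathbb{F}\cup\{X_1,X_2,\dots\}$ and an edge labeling $\sigma$ assigning to each edge a stack operation over $S$. A path $v_1\dots v_r$ has weight $\prod_{i} w(v_iv_{i+1})$ and operation sequence $\sigma(v_1v_2)\cdots\sigma(v_{r-1}v_r)$; it is stack-realizable if this sequence is realizable. The SBP computes $\sum_P w(P)$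 over all stack-realizable $s$-$t$-paths $P$. Its size is its number of vertices. *)

theory Defs
  imports "HOL-Library.Poly_Mapping" "HOL-Computational_Algebra.Polynomial"
begin

section \<open>Multivariate polynomials\<close>

text \<open>
  A monomial is a finitely supported exponent vector, and a polynomial is a finitely supported
  map from monomials to coefficients; multiplication on \<^typ>\<open>(nat \<Rightarrow>\<^sub>0 nat) \<Rightarrow>\<^sub>0 'a\<close> is convolution.
  The variables are indexed by \<^typ>\<open>nat\<close>, so the index \<open>i\<close> stands for $X_{i+1}$.
\<close>

type_synonym 'a mpoly = "(nat \<Rightarrow>\<^sub>0 nat) \<Rightarrow>\<^sub>0 'a"

definition monomial_degree :: "(nat \<Rightarrow>\<^sub>0 nat) \<Rightarrow> nat" where
  "monomial_degree m = (\<Sum>i\<in>Poly_Mapping.keys m. Poly_Mapping.lookup m i)"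

text \<open>The total degree; the zero polynomial gets degree 0.\<close>

definition total_degree :: "'a::zero mpoly \<Rightarrow> nat" where
  "total_degree f = Max (insert 0 (monomial_degree ` Poly_Mapping.keys f))"

datatype 'a label = Const 'a | Var nat

fun label_poly :: "'a::comm_semiring_1 label \<Rightarrow> 'a mpoly" where
  "label_poly (Const c) = Poly_Mapping.single 0 c"
| "label_poly (Var i) = Poly_Mapping.single (Poly_Mapping.single i 1) 1"


section \<open>Arithmetic circuits and VP\<close>

text \<open>
  The incoming wires of a gate are recorded in the gate itself. The two operands of a
  computation gate may coincide, i.e. parallel wires are allowed.
\<close>

datatype ('a, operands: 'g) gate = Input "'a label" | Plus 'g 'g | Times 'g 'g

record ('a, 'g) circuit =
  gates :: "'g set"
  kind :: "'g \<Rightarrow> ('a, 'g) gate"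
  output_gate :: 'g

definition wires :: "('a, 'g) circuit \<Rightarrow> ('g \<times> 'g) set" where
  "wires C = {(h, g). g \<in> gates C \<and> h \<in> operands (kind C g)}"

text \<open>The last conjunct says that the output gate is the only sink.\<close>

definition arith_circuit :: "('a, 'g) circuit \<Rightarrow> bool" where
  "arith_circuit C \<longleftrightarrow>
     finite (gates C) \<and>
     (\<forall>g\<in>gates C. operands (kind C g) \<subseteq> gates C) \<and>
     acyclic (wires C) \<and>
     {g \<in> gates C. \<forall>h. (g, h) \<notin> wires C} = {output_gate C}"

inductive gate_computes :: "('a::comm_semiring_1, 'g) circuit \<Rightarrow> 'g \<Rightarrow> 'a mpoly \<Rightarrow> bool"
  for C where
  input: "kind C g = Input l \<Longrightarrow> gate_computes C g (label_poly l)"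
| plus: "kind C g = Plus a b \<Longrightarrow> gate_computes C a p \<Longrightarrow> gate_computes C b q
           \<Longrightarrow> gate_computes C g (p + q)"
| times: "kind C g = Times a b \<Longrightarrow> gate_computes C a p \<Longrightarrow> gate_computes C b q
           \<Longrightarrow> gate_computes C g (p * q)"

definition circuit_computes :: "('a::comm_semiring_1, 'g) circuit \<Rightarrow> 'a mpoly \<Rightarrow> bool" where
  "circuit_computes C f \<longleftrightarrow> gate_computes C (output_gate C) f"

definition circuit_size :: "('a, 'g) circuit \<Rightarrow> nat" where
  "circuit_size C = card (gates C)"

lemma gate_computes_unique:
  "gate_computes C g p \<Longrightarrow> gate_computes C g q \<Longrightarrow> p = q"
proof (induction arbitrary: q rule: gate_computes.induct)
  case (input g l)
  from input(2,1) show ?case by cases auto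
next
  case (plus g a b p1 p2)
  from plus(6) plus(1,4,5) show ?case by cases auto
next
  case (times g a b p1 p2)
  from times(6) times(1,4,5) show ?case by cases auto
qed

lemma gate_computes_exists:
  assumes C: "arith_circuit C" and g: "g \<in> gates C"
  shows "\<exists>p. gate_computes C g p"
proof -
  have "wires C \<subseteq> gates C \<times> gates C"
    using C by (auto simp: arith_circuit_def wires_def)
  hence "finite (wires C)"
    using C by (auto simp: arith_circuit_def intro: finite_subset)
  hence "wf (wires C)"
    using C by (auto simp: arith_circuit_def intro: finite_acyclic_wf)
  thus ?thesis using g
  proof (induction g rule: wf_induct_rule)
    case (less g)
    have *: "\<exists>p. gate_computes C h p" if "h \<in> operands (kind C g)" for h
      using less C that by (auto simp: wires_def arith_circuit_def)
    show ?case
    proof (cases "kind C g")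
      case (Input l)
      thus ?thesis by (blast intro: gate_computes.input)
    next
      case (Plus a b)
      thus ?thesis using *[of a] *[of b] by (auto intro: gate_computes.plus)
    next
      case (Times a b)
      thus ?thesis using *[of a] *[of b] by (auto intro: gate_computes.times)
    qed
  qed
qed

definition VP :: "(nat \<Rightarrow> 'a::field mpoly) set" where
  "VP = {f.
     (\<exists>d :: nat poly. \<forall>n. total_degree (f n) \<le> poly d n) \<and>
     (\<exists>(q :: nat poly) (C :: nat \<Rightarrow> ('a, nat) circuit). \<forall>n.
        arith_circuit (C n) \<and> circuit_computes (C n) (f n) \<and> circuit_size (C n) \<le> poly q n)}"


section \<open>Stack branching programs\<close>

datatype (symbols: 's) stack_op = Push 's | Pop 's | Nop

inductive realizable :: "'s set \<Rightarrow> 's stack_op list \<Rightarrow> bool" for S where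
  empty: "realizable S []"
| push_pop: "realizable S P \<Longrightarrow> s \<in> S \<Longrightarrow> realizable S ([Push s] @ P @ [Pop s])"
| nop_left: "realizable S P \<Longrightarrow> realizable S ([Nop] @ P)"
| nop_right: "realizable S P \<Longrightarrow> realizable S (P @ [Nop])"
| append: "realizable S P \<Longrightarrow> realizable S Q \<Longrightarrow> realizable S (P @ Q)"

text \<open>The two labellings are only relevant on the edges.\<close>

record ('a, 'v, 's) sbp =
  verts :: "'v set"
  edges :: "('v \<times> 'v) set"
  source :: 'v
  target :: 'v
  weight :: "'v \<times> 'v \<Rightarrow> 'a label"
  alphabet :: "'s set"
  stack_op :: "'v \<times> 'v \<Rightarrow> 's stack_op"

definition stack_branching_program :: "('a, 'v, 's) sbp \<Rightarrow> bool" where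
  "stack_branching_program G \<longleftrightarrow>
     finite (verts G) \<and>
     edges G \<subseteq> verts G \<times> verts G \<and>
     acyclic (edges G) \<and>
     source G \<in> verts G \<and> target G \<in> verts G \<and>
     finite (alphabet G) \<and>
     (\<forall>e\<in>edges G. symbols (stack_op G e) \<subseteq> alphabet G)"

definition is_path :: "('a, 'v, 's) sbp \<Rightarrow> 'v list \<Rightarrow> bool" where
  "is_path G vs \<longleftrightarrow>
     vs \<noteq> [] \<and> set vs \<subseteq> verts G \<and> successively (\<lambda>u v. (u, v) \<in> edges G) vs"

definition path_edges :: "'v list \<Rightarrow> ('v \<times> 'v) list" where
  "path_edges vs = zip vs (tl vs)"

definition path_weight :: "('a::comm_semiring_1, 'v, 's) sbp \<Rightarrow> 'v list \<Rightarrow> 'a mpoly" where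
  "path_weight G vs = (\<Prod>e\<leftarrow>path_edges vs. label_poly (weight G e))"

definition path_ops :: "('a, 'v, 's) sbp \<Rightarrow> 'v list \<Rightarrow> 's stack_op list" where
  "path_ops G vs = map (stack_op G) (path_edges vs)"

definition realizable_st_paths :: "('a, 'v, 's) sbp \<Rightarrow> 'v list set" where
  "realizable_st_paths G =
     {vs. is_path G vs \<and> hd vs = source G \<and> last vs = target G
        \<and> realizable (alphabet G) (path_ops G vs)}"

definition sbp_poly :: "('a::comm_semiring_1, 'v, 's) sbp \<Rightarrow> 'a mpoly" where
  "sbp_poly G = (\<Sum>vs\<in>realizable_st_paths G. path_weight G vs)"

definition sbp_computes :: "('a::comm_semiring_1, 'v, 's) sbp \<Rightarrow> 'a mpoly \<Rightarrow> bool" where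
  "sbp_computes G f \<longleftrightarrow> sbp_poly G = f"

definition sbp_size :: "('a, 'v, 's) sbp \<Rightarrow> nat" where
  "sbp_size G = card (verts G)"

lemma finite_realizable_st_paths:
  assumes "stack_branching_program G"
  shows "finite (realizable_st_paths G)"
proof (rule finite_subset)
  have "distinct vs" if "is_path G vs" for vs
  proof -
    have "successively (\<lambda>u v. (u, v) \<in> (edges G)\<^sup>+) vs"
      using that by (auto simp: is_path_def elim!: successively_mono)
    hence "sorted_wrt (\<lambda>u v. (u, v) \<in> (edges G)\<^sup>+) vs"
      by (subst (asm) successively_conv_sorted_wrt) (auto simp: transp_def)
    moreover have "acyclic (edges G)"
      using assms by (simp add: stack_branching_program_def)
    ultimately show "distinct vs"
      by (induction vs) (auto simp: acyclic_def)
  qed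
  thus "realizable_st_paths G \<subseteq> {vs. set vs \<subseteq> verts G \<and> distinct vs}"
    by (auto simp: realizable_st_paths_def is_path_def)
  show "finite {vs. set vs \<subseteq> verts G \<and> distinct vs}"
    using assms by (auto simp: stack_branching_program_def intro: finite_subset_distinct)
qed

end

theory Submission
  imports Defs
begin

text \<open>
  A realizable operation sequence is one on which a stack machine runs from the empty stack to the
  empty stack, and summing the weights of all runs gives polynomials \<open>run_poly G v u st\<close>
  that satisfy a one-step recursion along the outgoing edges of \<open>u\<close>.

  From programs to circuits: by that recursion, a run with stack \<open>[s]\<close> factors through the edge
  popping \<open>s\<close>, so the quadratically many polynomials \<open>run_poly G v u []\<close> determine each other in
  reverse topological order of \<open>u\<close> with polynomially many operations each.

  From circuits to programs: a depth-first traversal of the parse trees of the circuit uses the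
  stack for pending second factors. To keep the program acyclic, each call carries the
  degree \<open>i\<close> of the homogeneous component to be computed and the number \<open>k\<close> of variables read so far;
  degree 0 components are scalars and become edge weights. A call \<open>(k, g, i)\<close> then always returns at
  \<open>k + i\<close>, and along each edge either \<open>k\<close> grows or the gate moves towards the inputs.
\<close>

subsection \<open>Degrees and homogeneous components\<close>

lemma monomial_degree_superset:
  assumes "finite A" "Poly_Mapping.keys m \<subseteq> A"
  shows "monomial_degree m = (\<Sum>i\<in>A. Poly_Mapping.lookup m i)"
  unfolding monomial_degree_def
  using assms by (intro sum.mono_neutral_left) (auto simp: in_keys_iff)

lemma monomial_degree_add: "monomial_degree (m + m') = monomial_degree m + monomial_degree m'"
proof -
  let ?A = "Poly_Mapping.keys m \<union> Poly_Mapping.keys m'"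
  have "monomial_degree (m + m') = (\<Sum>i\<in>?A. Poly_Mapping.lookup (m + m') i)"
    by (intro monomial_degree_superset) (use keys_add[of m m'] in auto)
  also have "\<dots> = monomial_degree m + monomial_degree m'"
    by (simp add: lookup_add sum.distrib monomial_degree_superset[of ?A m]
        monomial_degree_superset[of ?A m'])
  finally show ?thesis .
qed

lemma monomial_degree_0 [simp]: "monomial_degree 0 = 0"
  by (simp add: monomial_degree_def)

lemma monomial_degree_single [simp]: "monomial_degree (Poly_Mapping.single i k) = k"
  by (simp add: monomial_degree_def)

lemma monomial_degree_eq_0_iff: "monomial_degree m = 0 \<longleftrightarrow> m = 0"
proof
  assume "monomial_degree m = 0"
  hence "\<forall>i\<in>Poly_Mapping.keys m. Poly_Mapping.lookup m i = 0"
    by (simp add: monomial_degree_def)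
  thus "m = 0"
    by (intro poly_mapping_eqI) (auto simp: in_keys_iff)
qed simp

lemma total_degree_le_iff:
  "total_degree p \<le> d \<longleftrightarrow> (\<forall>m\<in>Poly_Mapping.keys p. monomial_degree m \<le> d)"
  by (simp add: total_degree_def)

lemma total_degree_mult:
  "total_degree (p * q) \<le> total_degree p + total_degree q"
  unfolding total_degree_le_iff
proof
  fix m assume "m \<in> Poly_Mapping.keys (p * q)"
  then obtain a b where ab: "m = a + b" "a \<in> Poly_Mapping.keys p" "b \<in> Poly_Mapping.keys q"
    using keys_mult[of p q] by blast
  hence "monomial_degree a \<le> total_degree p" "monomial_degree b \<le> total_degree q"
    using total_degree_le_iff by blast+
  thus "monomial_degree m \<le> total_degree p + total_degree q"
    by (simp add: ab monomial_degree_add)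
qed

lemma total_degree_sum_le:
  assumes "\<And>x. x \<in> A \<Longrightarrow> total_degree (p x) \<le> d"
  shows "total_degree (\<Sum>x\<in>A. p x) \<le> d"
  using assms
proof (induction A rule: infinite_finite_induct)
  case (insert x A)
  have "Poly_Mapping.keys (p x + (\<Sum>x\<in>A. p x))
          \<subseteq> Poly_Mapping.keys (p x) \<union> Poly_Mapping.keys (\<Sum>x\<in>A. p x)"
    by (rule keys_add)
  moreover have "total_degree (p x) \<le> d" "total_degree (\<Sum>x\<in>A. p x) \<le> d"
    using insert by auto
  ultimately show ?case
    unfolding sum.insert[OF insert(1,2)] total_degree_le_iff by blast
qed (simp_all add: total_degree_def)

lemma total_degree_label_poly: "total_degree (label_poly l) \<le> 1"
  by (cases l) (simp_all add: total_degree_le_iff)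

lemma total_degree_prod_list_labels:
  "total_degree (\<Prod>x\<leftarrow>xs. label_poly (l x)) \<le> length xs"
proof (induction xs)
  case Nil
  show ?case by (simp add: total_degree_def)
next
  case (Cons x xs)
  thus ?case
    using total_degree_mult[of "label_poly (l x)" "\<Prod>x\<leftarrow>xs. label_poly (l x)"]
      total_degree_label_poly[of "l x"]
    by simp
qed

section \<open>Homogeneous components under sums and products\<close>

definition hom_component :: "nat \<Rightarrow> 'a::comm_semiring_1 mpoly \<Rightarrow> 'a mpoly" where
  "hom_component i p =
     (\<Sum>m | m \<in> Poly_Mapping.keys p \<and> monomial_degree m = i.
        Poly_Mapping.single m (Poly_Mapping.lookup p m))"

lemma lookup_hom_component:
  "Poly_Mapping.lookup (hom_component i p) m
     = (if monomial_degree m = i then Poly_Mapping.lookup p m else 0)"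
proof -
  have "Poly_Mapping.lookup (hom_component i p) m =
     (\<Sum>m' | m' \<in> Poly_Mapping.keys p \<and> monomial_degree m' = i.
        if m' = m then Poly_Mapping.lookup p m else 0)"
    unfolding hom_component_def lookup_sum
    by (intro sum.cong) (auto simp: lookup_single when_def)
  thus ?thesis by (auto simp: in_keys_iff)
qed

lemma hom_component_add: "hom_component i (p + q) = hom_component i p + hom_component i q"
  by (rule poly_mapping_eqI) (simp add: lookup_hom_component lookup_add)

lemma hom_component_sum: "hom_component i (\<Sum>x\<in>A. p x) = (\<Sum>x\<in>A. hom_component i (p x))"
  by (rule poly_mapping_eqI) (simp add: lookup_hom_component lookup_sum)

lemma hom_component_single:
  "hom_component i (Poly_Mapping.single m c)
     = (if monomial_degree m = i then Poly_Mapping.single m c else 0)"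
  by (rule poly_mapping_eqI) (auto simp: lookup_hom_component lookup_single when_def)

lemma hom_component_0: "hom_component 0 p = Poly_Mapping.single 0 (Poly_Mapping.lookup p 0)"
  by (rule poly_mapping_eqI)
    (auto simp: lookup_hom_component lookup_single when_def monomial_degree_eq_0_iff)

lemma poly_mapping_sum_single:
  "p = (\<Sum>m\<in>Poly_Mapping.keys p. Poly_Mapping.single m (Poly_Mapping.lookup p m))"
  by (rule poly_mapping_eqI) (simp add: lookup_sum lookup_single when_def in_keys_iff)

text \<open>Only the index \<open>j = monomial_degree m\<close> can contribute; its term is the full
  product if the two degrees add up to \<open>i\<close>, and otherwise nothing is left.\<close>

lemma hom_component_mult_single:
  "hom_component i (Poly_Mapping.single m c * Poly_Mapping.single m' c') =
     (\<Sum>j\<le>i. hom_component j (Poly_Mapping.single m c)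
              * hom_component (i - j) (Poly_Mapping.single m' c'))"
proof -
  have "(\<Sum>j\<le>i. hom_component j (Poly_Mapping.single m c)
              * hom_component (i - j) (Poly_Mapping.single m' c')) =
        (\<Sum>j\<le>i. if j = monomial_degree m then
           (if monomial_degree m + monomial_degree m' = i
            then Poly_Mapping.single m c * Poly_Mapping.single m' c' else 0) else 0)"
    by (intro sum.cong) (auto simp: hom_component_single)
  thus ?thesis
    by (auto simp: mult_single hom_component_single monomial_degree_add)
qed

text \<open>Both sides are additive in each factor, so it suffices to compare them on pairs of
  monomials.\<close>

lemma hom_component_mult:
  "hom_component i (p * q) = (\<Sum>j\<le>i. hom_component j p * hom_component (i - j) q)"
proof -
  define P where "P m = Poly_Mapping.single m (Poly_Mapping.lookup p m)" for m
  define Q where "Q m = Poly_Mapping.single m (Poly_Mapping.lookup q m)" for m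
  have p: "p = sum P (Poly_Mapping.keys p)" and q: "q = sum Q (Poly_Mapping.keys q)"
    unfolding P_def Q_def by (rule poly_mapping_sum_single)+
  have "hom_component i (p * q) =
      (\<Sum>m\<in>Poly_Mapping.keys p. \<Sum>m'\<in>Poly_Mapping.keys q. hom_component i (P m * Q m'))"
    by (subst p, subst q) (simp only: sum_product hom_component_sum)
  also have "\<dots> = (\<Sum>m\<in>Poly_Mapping.keys p. \<Sum>m'\<in>Poly_Mapping.keys q. \<Sum>j\<le>i.
                   hom_component j (P m) * hom_component (i - j) (Q m'))"
    by (simp only: P_def Q_def hom_component_mult_single)
  also have "\<dots> = (\<Sum>j\<le>i. \<Sum>m\<in>Poly_Mapping.keys p. \<Sum>m'\<in>Poly_Mapping.keys q.
                   hom_component j (P m) * hom_component (i - j) (Q m'))"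
    by (simp only: sum.swap[of _ _ "{..i}"])
  also have "\<dots> = (\<Sum>j\<le>i. hom_component j (sum P (Poly_Mapping.keys p))
                       * hom_component (i - j) (sum Q (Poly_Mapping.keys q)))"
    by (simp only: sum_product hom_component_sum)
  finally show ?thesis
    by (simp only: p[symmetric] q[symmetric])
qed

lemma sum_hom_component:
  assumes "total_degree p \<le> d"
  shows "(\<Sum>i\<le>d. hom_component i p) = p"
proof (rule poly_mapping_eqI)
  fix m
  have "Poly_Mapping.lookup p m = 0" if "\<not> monomial_degree m \<le> d"
    using assms that by (auto simp: total_degree_le_iff in_keys_iff)
  thus "Poly_Mapping.lookup (\<Sum>i\<le>d. hom_component i p) m = Poly_Mapping.lookup p m"
    by (simp add: lookup_sum lookup_hom_component)
qed

subsection \<open>Straight-line programs\<close>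

definition slp_step :: "'a::comm_semiring_1 mpoly set \<Rightarrow> 'a mpoly set" where
  "slp_step A = range label_poly \<union> {p + q |p q. p \<in> A \<and> q \<in> A} \<union> {p * q |p q. p \<in> A \<and> q \<in> A}"

text \<open>A program is modelled by the set of polynomials available after \<open>k\<close> steps,
  starting from the given set \<open>A\<close>; no register names appear until a circuit is
  extracted. Recomputing an available polynomial still counts as a step.\<close>

inductive slp :: "'a::comm_semiring_1 mpoly set \<Rightarrow> nat \<Rightarrow> 'a mpoly set \<Rightarrow> bool" for A where
  refl: "slp A 0 A"
| step: "slp A k B \<Longrightarrow> p \<in> slp_step B \<Longrightarrow> slp A (Suc k) (insert p B)"

lemma slp_step_mono: "A \<subseteq> B \<Longrightarrow> slp_step A \<subseteq> slp_step B"
  unfolding slp_step_def by fast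

lemma slp_superset: "slp A k B \<Longrightarrow> A \<subseteq> B"
  by (induction rule: slp.induct) auto

lemma slp_Un: "slp A k B \<Longrightarrow> slp (A \<union> C) k (B \<union> C)"
proof (induction rule: slp.induct)
  case (step k B p)
  thus ?case
    using slp.step[of "A \<union> C" k "B \<union> C" p] slp_step_mono[of B "B \<union> C"] by auto
qed (rule slp.refl)

lemma slp_trans: "slp B l C \<Longrightarrow> slp A k B \<Longrightarrow> slp A (k + l) C"
  by (induction rule: slp.induct) (auto intro: slp.step)

text \<open>The bound \<open>k\<close> and the superset \<open>B\<close> make the relation stable
  under enlarging \<open>A\<close> and \<open>k\<close> and shrinking \<open>P\<close>, so costs can
  be rounded up and by-products ignored.\<close>

definition slp_computes :: "'a::comm_semiring_1 mpoly set \<Rightarrow> nat \<Rightarrow> 'a mpoly set \<Rightarrow> bool" where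
  "slp_computes A k P \<longleftrightarrow> (\<exists>l\<le>k. \<exists>B. slp A l B \<and> P \<subseteq> B)"

lemma slp_computes_subset: "P \<subseteq> A \<Longrightarrow> slp_computes A k P"
  unfolding slp_computes_def by (auto intro: slp.refl)

lemma slp_computes_mono:
  assumes "slp_computes A k P" "A \<subseteq> A'" "k \<le> k'" "P' \<subseteq> P"
  shows "slp_computes A' k' P'"
proof -
  from assms(1) obtain l B where l: "l \<le> k" "slp A l B" "P \<subseteq> B"
    unfolding slp_computes_def by blast
  from slp_Un[OF l(2), of A'] have "slp A' l (B \<union> A')"
    using assms(2) by (simp add: Un_absorb1)
  thus ?thesis
    unfolding slp_computes_def using l(1,3) assms(3,4) by (intro exI[of _ l]) auto
qed

lemma slp_computes_trans:
  assumes "slp_computes A k P" "slp_computes (A \<union> P) l Q"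
  shows "slp_computes A (k + l) (P \<union> Q)"
proof -
  from assms(1) obtain k' B where k': "k' \<le> k" "slp A k' B" "P \<subseteq> B"
    unfolding slp_computes_def by blast
  from assms(2) obtain l' C where l': "l' \<le> l" "slp (A \<union> P) l' C" "Q \<subseteq> C"
    unfolding slp_computes_def by blast
  have "slp B l' (C \<union> B)"
    using slp_Un[OF l'(2), of B] slp_superset[OF k'(2)] k'(3) by (simp add: Un_absorb1)
  from slp_trans[OF this k'(2)] show ?thesis
    unfolding slp_computes_def using k'(1,3) l'(1,3) 
    by (intro exI[of _ "k' + l'"]) auto
qed

lemma slp_computes_Un:
  "slp_computes A k P \<Longrightarrow> slp_computes A l Q \<Longrightarrow> slp_computes A (k + l) (P \<union> Q)"
  by (rule slp_computes_trans) (auto elim: slp_computes_mono)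

lemma slp_computes_UNION:
  assumes "finite I" "\<And>i. i \<in> I \<Longrightarrow> slp_computes A k (P i)"
  shows "slp_computes A (card I * k) (\<Union>i\<in>I. P i)"
  using assms
proof (induction I rule: finite_induct)
  case empty
  show ?case by (simp add: slp_computes_subset)
next
  case (insert i I)
  have "slp_computes A (k + card I * k) (P i \<union> (\<Union>i\<in>I. P i))"
    by (rule slp_computes_Un) (use insert in auto)
  thus ?case
    using insert(1,2) by simp
qed

lemma slp_computes_step:
  assumes "slp_computes A k P" "p \<in> slp_step P"
  shows "slp_computes A (Suc k) {p}"
proof -
  from assms(1) obtain l B where l: "l \<le> k" "slp A l B" "P \<subseteq> B"
    unfolding slp_computes_def by blast
  have "slp A (Suc l) (insert p B)"
    using slp.step[OF l(2)] slp_step_mono[OF l(3)] assms(2) by blast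
  thus ?thesis
    unfolding slp_computes_def using l(1) by (intro exI[of _ "Suc l"]) auto
qed

lemma slp_computes_label: "slp_computes A (Suc 0) {label_poly l}"
  by (rule slp_computes_step[of _ _ "{}"]) (auto simp: slp_step_def slp_computes_subset)

lemma slp_computes_add:
  assumes "slp_computes A k {p}" "slp_computes A l {q}"
  shows "slp_computes A (Suc (k + l)) {p + q}"
  using slp_computes_Un[OF assms] by (rule slp_computes_step) (auto simp: slp_step_def)

lemma slp_computes_mult:
  assumes "slp_computes A k {p}" "slp_computes A l {q}"
  shows "slp_computes A (Suc (k + l)) {p * q}"
  using slp_computes_Un[OF assms] by (rule slp_computes_step) (auto simp: slp_step_def)

lemma slp_computes_0: "slp_computes A (Suc 0) {0}"
  using slp_computes_label[of A "Const 0"] by simp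

lemma slp_computes_1: "slp_computes A (Suc 0) {1}"
  using slp_computes_label[of A "Const 1"] by simp

text \<open>Each summand costs \<open>k\<close> steps and one addition; the extra step creates the
  constant 0 of the empty sum.\<close>

lemma slp_computes_sum:
  assumes "finite I" "\<And>i. i \<in> I \<Longrightarrow> slp_computes A k {p i}"
  shows "slp_computes A (Suc (card I * Suc k)) {\<Sum>i\<in>I. p i}"
  using assms
proof (induction I rule: finite_induct)
  case empty
  show ?case using slp_computes_0 by simp
next
  case (insert i I)
  have "slp_computes A (Suc (k + Suc (card I * Suc k))) {p i + (\<Sum>i\<in>I. p i)}"
    by (rule slp_computes_add) (use insert in auto)
  thus ?case
    using insert(1,2) by (simp add: ac_simps)
qed

text \<open>Listing the polynomials by time of computation numbers the future gates. Repetitions are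
  kept, so the length is the number of steps rather than the cardinality of
  \<open>B\<close>.\<close>

lemma slp_list:
  assumes "slp {} k B"
  shows "\<exists>ps. length ps = k \<and> set ps = B \<and> (\<forall>i<k. ps ! i \<in> slp_step (set (take i ps)))"
  using assms
proof (induction rule: slp.induct)
  case refl
  show ?case by simp
next
  case (step k B p)
  then obtain ps where ps: "length ps = k" "set ps = B"
    "\<And>i. i < k \<Longrightarrow> ps ! i \<in> slp_step (set (take i ps))"
    by blast
  have "(ps @ [p]) ! i \<in> slp_step (set (take i (ps @ [p])))" if "i < Suc k" for i
    using that ps step(2) by (cases "i = k") (auto simp: nth_append)
  thus ?case
    using ps by (intro exI[of _ "ps @ [p]"]) auto
qed

text \<open>Only the gates from which the output is reachable are kept, since it must be the only sink.\<close>

lemma circuit_of_slp: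
  assumes "slp_computes {} k {p}"
  shows "\<exists>C :: ('a::comm_semiring_1, nat) circuit.
           arith_circuit C \<and> circuit_computes C p \<and> circuit_size C \<le> k"
proof -
  from assms obtain l B where l: "l \<le> k" "slp {} l B" "p \<in> B"
    unfolding slp_computes_def by blast
  from slp_list[OF l(2)] obtain ps where len: "length ps = l" and B: "set ps = B"
    and ps: "\<And>i. i < l \<Longrightarrow> ps ! i \<in> slp_step (set (take i ps))"
    by blast
  define good where "good i kd \<longleftrightarrow> (case kd of
      Input l \<Rightarrow> ps ! i = label_poly l
    | Plus a b \<Rightarrow> a < i \<and> b < i \<and> ps ! i = ps ! a + ps ! b
    | Times a b \<Rightarrow> a < i \<and> b < i \<and> ps ! i = ps ! a * ps ! b)" for i and kd :: "('a, nat) gate"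
  have "\<exists>kd. good i kd" if i: "i < l" for i
  proof -
    have take: "\<exists>a<i. q = ps ! a" if "q \<in> set (take i ps)" for q
      using that by (auto simp: in_set_conv_nth)
    from ps[OF i] consider l where "ps ! i = label_poly l"
      | p q where "p \<in> set (take i ps)" "q \<in> set (take i ps)" "ps ! i = p + q"
      | p q where "p \<in> set (take i ps)" "q \<in> set (take i ps)" "ps ! i = p * q"
      unfolding slp_step_def by blast
    thus ?thesis
    proof cases
      case (1 l)
      thus ?thesis by (intro exI[of _ "Input l"]) (simp add: good_def)
    next
      case (2 p q)
      then obtain a b where "a < i" "p = ps ! a" "b < i" "q = ps ! b"
        using take by blast
      with 2 show ?thesis by (intro exI[of _ "Plus a b"]) (simp add: good_def)
    next
      case (3 p q)
      then obtain a b where "a < i" "p = ps ! a" "b < i" "q = ps ! b"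
        using take by blast
      with 3 show ?thesis by (intro exI[of _ "Times a b"]) (simp add: good_def)
    qed
  qed
  then obtain kd where kd: "\<And>i. i < l \<Longrightarrow> good i (kd i)"
    by metis
  have operand_less: "a < i" if "a \<in> operands (kd i)" "i < l" for a i
    using kd[OF that(2)] that(1) by (cases "kd i") (auto simp: good_def)
  obtain out where out: "out < l" "ps ! out = p"
    using l(3) B len by (metis in_set_conv_nth)
  define W where "W = {(a, i). i < l \<and> a \<in> operands (kd i)}"
  define C where "C = \<lparr>gates = {i. (i, out) \<in> W\<^sup>*}, kind = kd, output_gate = out\<rparr>"
  have gates_iff: "i \<in> gates C \<longleftrightarrow> (i, out) \<in> W\<^sup>*" for i
    by (simp add: C_def)
  have W_less: "a < i" if "(a, i) \<in> W" for a i
    using that operand_less by (auto simp: W_def)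
  have le: "i \<le> out" if "(i, out) \<in> W\<^sup>*" for i
    using that by (induction rule: converse_rtrancl_induct) (auto dest: W_less)
  have gates: "i < l" if "i \<in> gates C" for i
    using that le[of i] out(1) by (auto simp: C_def)
  have closed: "a \<in> gates C" if "i \<in> gates C" "a \<in> operands (kd i)" for a i
  proof -
    have "(a, i) \<in> W"
      using that gates by (auto simp: W_def)
    thus ?thesis
      using that by (auto simp: C_def intro: converse_rtrancl_into_rtrancl)
  qed
  have wires: "wires C = W \<inter> UNIV \<times> gates C"
    using gates by (auto simp: wires_def W_def C_def)
  \<comment> \<open>Wires lead to larger positions below \<open>l\<close>, so \<open>l - i\<close>
    strictly decreases along them.\<close>
  have "acyclic W"
    by (rule acyclicI_order[of _ "\<lambda>i. l - i"]) (use W_def W_less in fastforce)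
  hence acyclic: "acyclic (wires C)"
    by (rule acyclic_subset) (auto simp: wires)
  have "{g \<in> gates C. \<forall>h. (g, h) \<notin> wires C} = {out}"
  proof (intro equalityI subsetI)
    fix g assume g: "g \<in> {g \<in> gates C. \<forall>h. (g, h) \<notin> wires C}"
    hence "(g, out) \<in> W\<^sup>*"
      by (simp add: C_def)
    \<comment> \<open>If \<open>g\<close> is not \<open>out\<close>, its path to \<open>out\<close>
      has a first wire, whose end is again a kept gate; hence \<open>g\<close> is no sink.\<close>
    thus "g \<in> {out}"
    proof (cases rule: converse_rtranclE)
      case (step h)
      hence "(g, h) \<in> wires C"
        by (auto simp: wires gates_iff)
      thus ?thesis using g by auto
    qed auto
  next
    fix g assume "g \<in> {out}"
    moreover have "(out, h) \<notin> wires C" for h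
      using le[of h] W_less[of out h] by (auto simp: wires gates_iff)
    ultimately show "g \<in> {g \<in> gates C. \<forall>h. (g, h) \<notin> wires C}"
      by (auto simp: C_def)
  qed
  moreover have "finite (gates C)"
    by (rule finite_subset[of _ "{..<l}"]) (use gates in auto)
  ultimately have circ: "arith_circuit C"
    using acyclic closed by (auto simp: arith_circuit_def C_def)
  \<comment> \<open>\<open>gate_computes\<close> refers only to \<open>kind\<close>, so the
    induction can run over all positions, including the discarded ones.\<close>
  have "gate_computes C i (ps ! i)" if "i < l" for i
    using that
  proof (induction i rule: less_induct)
    case (less i)
    have kind: "kind C i = kd i"
      by (simp add: C_def)
    show ?case
    proof (cases "kd i")
      case (Input l)
      thus ?thesis
        using kd[OF less(2)] gate_computes.input[of C i l] kind by (simp add: good_def)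
    next
      case (Plus a b)
      thus ?thesis
        using kd[OF less(2)] gate_computes.plus[of C i a b] kind less by (simp add: good_def)
    next
      case (Times a b)
      thus ?thesis
        using kd[OF less(2)] gate_computes.times[of C i a b] kind less by (simp add: good_def)
    qed
  qed
  hence "circuit_computes C p"
    using out by (auto simp: circuit_computes_def C_def)
  moreover have "circuit_size C \<le> k"
    using card_mono[of "{..<l}" "gates C"] gates l(1) by (force simp: circuit_size_def)
  ultimately show ?thesis
    using circ by blast
qed

subsection \<open>Stack machine semantics of branching programs\<close>

fun exec_op :: "'s stack_op \<Rightarrow> 's list \<Rightarrow> 's list option" where
  "exec_op (Push s) st = Some (s # st)"
| "exec_op (Pop s) [] = None"
| "exec_op (Pop s) (r # st) = (if r = s then Some st else None)"
| "exec_op Nop st = Some st"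

fun exec :: "'s stack_op list \<Rightarrow> 's list \<Rightarrow> 's list option" where
  "exec [] st = Some st"
| "exec (x # xs) st = Option.bind (exec_op x st) (exec xs)"

text \<open>Popping the empty stack is the only case in which the part of the stack below
  \<open>st\<close> matters.\<close>

lemma exec_op_append:
  "\<not> (\<exists>r. x = Pop r \<and> st = []) \<Longrightarrow>
   exec_op x (st @ st') = map_option (\<lambda>st''. st'' @ st') (exec_op x st)"
  by (cases x; cases st) auto

lemma exec_append: "exec (xs @ ys) st = Option.bind (exec xs st) (exec ys)"
proof (induction xs arbitrary: st)
  case (Cons x xs)
  thus ?case by (cases "exec_op x st") auto
qed simp

text \<open>The arbitrary initial stack makes the induction work: inside a push-pop pair the
  sequence runs above the pushed symbol.\<close>

lemma exec_realizable: "realizable S P \<Longrightarrow> exec P st = Some st"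
  by (induction arbitrary: st rule: realizable.induct) (auto simp: exec_append)

text \<open>The sequence is cut at the pop that removes the bottom symbol \<open>s\<close>; until
  then the machine runs as if \<open>s\<close> were not there.\<close>

lemma exec_to_Nil_split:
  assumes "exec P (st @ [s]) = Some []"
  shows "\<exists>P1 P2. P = P1 @ [Pop s] @ P2 \<and> exec P1 st = Some [] \<and> exec P2 [] = Some []"
  using assms
proof (induction P arbitrary: st)
  case (Cons x P)
  show ?case
  proof (cases "\<exists>r. x = Pop r \<and> st = []")
    case True
    with Cons.prems have "x = Pop s" "exec P [] = Some []" "st = []"
      by (auto split: if_splits)
    thus ?thesis
      by (intro exI[of _ "[]"] exI[of _ P]) simp
  next
    case False
    then obtain st' where st': "exec_op x st = Some st'" "exec P (st' @ [s]) = Some []"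
      using Cons.prems by (cases x; cases st) (auto split: if_splits)
    from Cons.IH[OF this(2)] obtain P1 P2
      where "P = P1 @ [Pop s] @ P2" "exec P1 st' = Some []" "exec P2 [] = Some []"
      by blast
    thus ?thesis
      using st'(1) by (intro exI[of _ "x # P1"] exI[of _ P2]) simp
  qed
qed simp

text \<open>For the backward direction, a leading push is matched with the pop found by
  \<open>exec_to_Nil_split\<close>; the parts between and after them are shorter, so the induction
  is on the length.\<close>

lemma realizable_iff_exec:
  assumes "\<And>x. x \<in> set P \<Longrightarrow> symbols x \<subseteq> S"
  shows "realizable S P \<longleftrightarrow> exec P [] = Some []"
proof
  assume "exec P [] = Some []"
  thus "realizable S P"
    using assms
  proof (induction P rule: length_induct)
    case (1 P)
    show ?case
    proof (cases P)
      case Nil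
      thus ?thesis by (simp add: realizable.empty)
    next
      case P: (Cons x P')
      show ?thesis
      proof (cases x)
        case (Push s)
        with 1 P have "exec P' ([] @ [s]) = Some []"
          by simp
        from exec_to_Nil_split[OF this] obtain P1 P2
          where P': "P' = P1 @ [Pop s] @ P2" "exec P1 [] = Some []" "exec P2 [] = Some []"
          by blast
        have "symbols x \<subseteq> S"
          using "1.prems" P by auto
        hence "s \<in> S"
          by (simp add: Push)
        moreover have "realizable S P1" "realizable S P2"
          using 1 P Push P' by (auto simp: P P')
        ultimately have "realizable S (([Push s] @ P1 @ [Pop s]) @ P2)"
          by (intro realizable.append realizable.push_pop)
        thus ?thesis
          by (simp add: P P' Push)
      next
        case (Pop s)
        thus ?thesis using 1 P by simp
      next
        case Nop
        have "realizable S P'"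
          using 1 P Nop by simp
        thus ?thesis
          using realizable.nop_left[of S P'] by (simp add: P Nop)
      qed
    qed
  qed
qed (rule exec_realizable)

section \<open>Run polynomials and their one-step recursion\<close>

definition run_paths :: "('a, 'v, 's) sbp \<Rightarrow> 'v \<Rightarrow> 'v \<Rightarrow> 's list \<Rightarrow> 'v list set" where
  "run_paths G v u st =
     {vs. is_path G vs \<and> hd vs = u \<and> last vs = v \<and> exec (path_ops G vs) st = Some []}"

text \<open>The initial stack is a parameter because cutting off the first edge of a run leaves a
  run whose stack may be nonempty.\<close>

definition run_poly ::
  "('a::comm_semiring_1, 'v, 's) sbp \<Rightarrow> 'v \<Rightarrow> 'v \<Rightarrow> 's list \<Rightarrow> 'a mpoly" where
  "run_poly G v u st = (\<Sum>vs\<in>run_paths G v u st. path_weight G vs)"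

lemma path_edges_Cons_Cons: "path_edges (u # x # vs) = (u, x) # path_edges (x # vs)"
  by (simp add: path_edges_def)

lemma path_edges_single: "path_edges [u] = []"
  by (simp add: path_edges_def)

lemma is_path_Cons_Cons:
  "is_path G (u # x # vs) \<longleftrightarrow> u \<in> verts G \<and> (u, x) \<in> edges G \<and> is_path G (x # vs)"
  by (auto simp: is_path_def)

lemma set_path_edges: "is_path G vs \<Longrightarrow> set (path_edges vs) \<subseteq> edges G"
proof (induction vs rule: induct_list012)
  case (3 x y zs)
  thus ?case by (simp add: path_edges_Cons_Cons is_path_Cons_Cons)
qed (simp_all add: path_edges_def)

locale stack_bp =
  fixes G :: "('a::comm_semiring_1, 'v, 's) sbp"
  assumes sbp: "stack_branching_program G"
begin

lemma finite_verts: "finite (verts G)"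
  and edges_subset: "edges G \<subseteq> verts G \<times> verts G"
  and acyclic_edges: "acyclic (edges G)"
  and source_in_verts: "source G \<in> verts G"
  and target_in_verts: "target G \<in> verts G"
  using sbp by (auto simp: stack_branching_program_def)

lemma finite_edges: "finite (edges G)"
  using finite_verts edges_subset by (auto intro: finite_subset)

lemma card_edges: "card (edges G) \<le> card (verts G) * card (verts G)"
  using card_mono[OF _ edges_subset] finite_verts by (simp add: card_cartesian_product)

lemma finite_succs: "finite (edges G `` {u})"
  by (rule finite_subset[of _ "verts G"]) (use finite_verts edges_subset in auto)

lemma card_succs: "card (edges G `` {u}) \<le> card (verts G)"
  by (rule card_mono) (use finite_verts edges_subset in auto)

lemma is_path_distinct: "is_path G vs \<Longrightarrow> distinct vs"
proof -
  assume "is_path G vs"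
  hence "successively (\<lambda>u v. (u, v) \<in> (edges G)\<^sup>+) vs"
    by (auto simp: is_path_def elim!: successively_mono)
  hence "sorted_wrt (\<lambda>u v. (u, v) \<in> (edges G)\<^sup>+) vs"
    by (subst (asm) successively_conv_sorted_wrt) (auto simp: transp_def)
  thus "distinct vs"
    using acyclic_edges by (induction vs) (auto simp: acyclic_def)
qed

lemma finite_paths: "finite {vs. is_path G vs}"
proof (rule finite_subset)
  show "{vs. is_path G vs} \<subseteq> {vs. set vs \<subseteq> verts G \<and> distinct vs}"
    using is_path_distinct by (auto simp: is_path_def)
  show "finite {vs. set vs \<subseteq> verts G \<and> distinct vs}"
    by (rule finite_subset_distinct[OF finite_verts])
qed

lemma finite_run_paths: "finite (run_paths G v u st)"
  by (rule finite_subset[OF _ finite_paths]) (auto simp: run_paths_def)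

lemma sbp_poly_eq_run_poly: "sbp_poly G = run_poly G (target G) (source G) []"
proof -
  have "realizable (alphabet G) (path_ops G vs) \<longleftrightarrow> exec (path_ops G vs) [] = Some []"
    if path: "is_path G vs" for vs
  proof (rule realizable_iff_exec)
    fix x assume "x \<in> set (path_ops G vs)"
    then obtain e where "e \<in> edges G" "x = stack_op G e"
      using set_path_edges[OF path] by (auto simp: path_ops_def)
    thus "symbols x \<subseteq> alphabet G"
      using sbp by (auto simp: stack_branching_program_def)
  qed
  hence "realizable_st_paths G = run_paths G (target G) (source G) []"
    by (auto simp: realizable_st_paths_def run_paths_def)
  thus ?thesis
    by (simp add: sbp_poly_def run_poly_def)
qed

text \<open>Paths in an acyclic graph repeat no vertex, and each edge contributes a factor of degree
  at most 1.\<close>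

lemma total_degree_sbp_poly: "total_degree (sbp_poly G) \<le> card (verts G)"
  unfolding sbp_poly_def
proof (rule total_degree_sum_le)
  fix vs assume "vs \<in> realizable_st_paths G"
  hence "is_path G vs"
    by (simp add: realizable_st_paths_def)
  hence "length vs \<le> card (verts G)"
    using is_path_distinct[of vs] card_mono[OF finite_verts, of "set vs"]
    by (simp add: distinct_card is_path_def)
  moreover have "length (path_edges vs) \<le> length vs"
    by (simp add: path_edges_def)
  ultimately show "total_degree (path_weight G vs) \<le> card (verts G)"
    using total_degree_prod_list_labels[of "weight G" "path_edges vs"]
    unfolding path_weight_def by linarith
qed

definition step_poly :: "'v \<Rightarrow> 'v \<Rightarrow> 's list \<Rightarrow> 'v \<Rightarrow> 'a mpoly" where
  "step_poly v u st x = label_poly (weight G (u, x)) *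
     (case exec_op (stack_op G (u, x)) st of None \<Rightarrow> 0 | Some st' \<Rightarrow> run_poly G v x st')"

text \<open>Runs are sorted by their first edge. The only run without an edge is the one-vertex
  path, which counts if it is already at \<open>v\<close> with an empty stack.\<close>

lemma run_poly_rec:
  assumes u: "u \<in> verts G"
  shows "run_poly G v u st =
    (if u = v \<and> st = [] then 1 else 0) + (\<Sum>x\<in>edges G `` {u}. step_poly v u st x)"
proof -
  define A where "A = (if u = v \<and> st = [] then {[u]} else {})"
  define B where "B x = (case exec_op (stack_op G (u, x)) st of
      None \<Rightarrow> {} | Some st' \<Rightarrow> (#) u ` run_paths G v x st')" for x
  let ?X = "edges G `` {u}"
  have split: "run_paths G v u st = A \<union> (\<Union>x\<in>?X. B x)"
  proof (intro equalityI subsetI)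
    fix vs assume vs: "vs \<in> run_paths G v u st"
    show "vs \<in> A \<union> (\<Union>x\<in>?X. B x)"
    proof (cases vs rule: remdups_adj.cases)
      case 1
      with vs show ?thesis by (simp add: run_paths_def is_path_def)
    next
      case (2 w)
      with vs show ?thesis
        by (auto simp: A_def run_paths_def path_ops_def path_edges_single)
    next
      case (3 w x vs')
      with vs have "w = u" and x: "x \<in> ?X"
        by (auto simp: run_paths_def is_path_Cons_Cons)
      moreover have "vs \<in> B x"
        using vs 3 by (auto simp: B_def run_paths_def path_ops_def path_edges_Cons_Cons
            is_path_Cons_Cons bind_eq_Some_conv split: option.splits)
      ultimately show ?thesis by blast
    qed
  next
    fix vs assume "vs \<in> A \<union> (\<Union>x\<in>?X. B x)"
    thus "vs \<in> run_paths G v u st"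
    proof
      assume "vs \<in> A"
      thus ?thesis
        using u by (auto simp: A_def run_paths_def path_ops_def path_edges_single is_path_def
            split: if_splits)
    next
      assume "vs \<in> (\<Union>x\<in>?X. B x)"
      then obtain x st' vs' where x: "x \<in> ?X" "exec_op (stack_op G (u, x)) st = Some st'"
        "vs = u # vs'" "vs' \<in> run_paths G v x st'"
        by (auto simp: B_def split: option.splits)
      then obtain vs'' where "vs' = x # vs''"
        by (cases vs') (auto simp: run_paths_def is_path_def)
      with x u show ?thesis
        by (auto simp: run_paths_def path_ops_def path_edges_Cons_Cons is_path_Cons_Cons)
    qed
  qed
  \<comment> \<open>The second vertex of a path in \<open>B x\<close> is \<open>x\<close>, so these
    sets are pairwise disjoint; having at least two vertices separates them from
    \<open>A\<close>.\<close>
  have hd_tl: "hd (tl vs) = x" "length vs > 1" if "vs \<in> B x" for vs x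
    using that by (auto simp: B_def run_paths_def is_path_def split: option.splits)
  have finB: "finite (B x)" for x
    by (auto simp: B_def finite_run_paths split: option.splits)
  have B: "sum (path_weight G) (B x) = step_poly v u st x" for x
  proof (cases "exec_op (stack_op G (u, x)) st")
    case None
    thus ?thesis by (simp add: B_def step_poly_def)
  next
    case (Some st')
    have "path_weight G (u # vs) = label_poly (weight G (u, x)) * path_weight G vs"
      if "vs \<in> run_paths G v x st'" for vs
      using that by (cases vs)
        (auto simp: run_paths_def is_path_def path_weight_def path_edges_Cons_Cons)
    thus ?thesis
      by (simp add: B_def step_poly_def Some sum.reindex run_poly_def sum_distrib_left)
  qed
  have "run_poly G v u st = sum (path_weight G) A + sum (path_weight G) (\<Union>x\<in>?X. B x)"
    unfolding run_poly_def split
  proof (rule sum.union_disjoint)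
    show "A \<inter> (\<Union>x\<in>?X. B x) = {}"
      using hd_tl(2) by (fastforce simp: A_def split: if_splits)
  qed (use finite_succs finB in \<open>auto simp: A_def\<close>)
  also have "sum (path_weight G) (\<Union>x\<in>?X. B x) = (\<Sum>x\<in>?X. sum (path_weight G) (B x))"
    by (rule sum.UNION_disjoint) (use finite_succs finB hd_tl(1) in blast)+
  also have "sum (path_weight G) A = (if u = v \<and> st = [] then 1 else 0)"
    by (simp add: A_def path_weight_def path_edges_single)
  finally show ?thesis
    by (simp add: B)
qed

lemma vertex_induct [consumes 1, case_names less]:
  assumes "u \<in> verts G"
    and "\<And>u. u \<in> verts G \<Longrightarrow> (\<And>x. (u, x) \<in> edges G \<Longrightarrow> P x) \<Longrightarrow> P u"
  shows "P u"
proof -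
  have "wf ((edges G)\<inverse>)"
    by (rule finite_acyclic_wf_converse[OF finite_edges acyclic_edges])
  thus ?thesis
    using assms(1)
  proof (induction u rule: wf_induct_rule)
    case (less u)
    show ?case
      by (rule assms(2)[OF less(2)]) (use less(1) edges_subset in auto)
  qed
qed

text \<open>A run that empties a stack with bottom symbol \<open>s\<close> is cut at the edge that pops this \<open>s\<close>.\<close>

lemma run_poly_snoc:
  assumes "u \<in> verts G"
  shows "run_poly G v u (st @ [s]) =
    (\<Sum>(b, c)\<in>{e \<in> edges G. stack_op G e = Pop s}.
       run_poly G b u st * label_poly (weight G (b, c)) * run_poly G v c [])"
  using assms
proof (induction u arbitrary: st rule: vertex_induct)
  case (less u)
  let ?E = "{e \<in> edges G. stack_op G e = Pop s}"
  let ?X = "edges G `` {u}"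
  define t where "t b c = label_poly (weight G (b, c)) * run_poly G v c []" for b c
  have IH: "run_poly G v x (st @ [s]) = (\<Sum>(b, c)\<in>?E. run_poly G b x st * t b c)"
    if "x \<in> ?X" for x st
    using less(2)[of x st] that by (simp add: t_def mult.assoc)
  have finE: "finite ?E"
    using finite_edges by simp
  \<comment> \<open>These are the runs whose part before the pop of \<open>s\<close> is empty: the
    cutting edge is then an outgoing edge of \<open>u\<close>.\<close>
  have first: "(\<Sum>(b, c)\<in>?E. (if u = b \<and> st = [] then 1 else 0) * t b c) =
      (\<Sum>x\<in>?X. if st = [] \<and> stack_op G (u, x) = Pop s then t u x else 0)"
  proof -
    have "(\<Sum>(b, c)\<in>?E. (if u = b \<and> st = [] then 1 else 0) * t b c) =
          (\<Sum>(b, c)\<in>{e \<in> ?E. fst e = u \<and> st = []}. t b c)"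
      by (rule sum.mono_neutral_cong_right) (use finE in \<open>auto split: if_splits\<close>)
    also have "\<dots> = (\<Sum>x\<in>{x \<in> ?X. st = [] \<and> stack_op G (u, x) = Pop s}. t u x)"
      by (rule sum.reindex_bij_witness[of _ "Pair u" snd]) auto
    also have "\<dots> = (\<Sum>x\<in>?X. if st = [] \<and> stack_op G (u, x) = Pop s then t u x else 0)"
      by (rule sum.mono_neutral_cong_left) (use finite_succs in auto)
    finally show ?thesis .
  qed
  \<comment> \<open>If the first edge is a pop and \<open>st\<close> is empty, it acts on
    \<open>s\<close> itself and every \<open>step_poly b u [] x\<close> is 0. Otherwise it leaves
    \<open>s\<close> alone and the induction hypothesis applies at \<open>x\<close>.\<close>
  have step: "step_poly v u (st @ [s]) x =
      (if st = [] \<and> stack_op G (u, x) = Pop s then t u x else 0) +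
      (\<Sum>(b, c)\<in>?E. step_poly b u st x * t b c)" if x: "x \<in> ?X" for x
  proof (cases "\<exists>r. stack_op G (u, x) = Pop r \<and> st = []")
    case True
    thus ?thesis
      by (auto simp: step_poly_def t_def)
  next
    case False
    note append = exec_op_append[OF this, of "[s]"]
    show ?thesis
    proof (cases "exec_op (stack_op G (u, x)) st")
      case None
      thus ?thesis
        using False append by (auto simp: step_poly_def)
    next
      case (Some st')
      thus ?thesis
        using False append IH[OF x, of st']
        by (auto simp: step_poly_def sum_distrib_left mult.assoc case_prod_unfold)
    qed
  qed
  have "run_poly G v u (st @ [s]) = (\<Sum>x\<in>?X. step_poly v u (st @ [s]) x)"
    by (simp add: run_poly_rec[OF less(1)])
  also have "\<dots> = (\<Sum>x\<in>?X. if st = [] \<and> stack_op G (u, x) = Pop s then t u x else 0)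
      + (\<Sum>x\<in>?X. \<Sum>(b, c)\<in>?E. step_poly b u st x * t b c)"
    by (simp add: step sum.distrib)
  also have "\<dots> = (\<Sum>(b, c)\<in>?E. (if u = b \<and> st = [] then 1 else 0) * t b c)
      + (\<Sum>(b, c)\<in>?E. (\<Sum>x\<in>?X. step_poly b u st x) * t b c)"
    unfolding case_prod_unfold sum_distrib_right
    by (subst sum.swap) (simp add: first[unfolded case_prod_unfold])
  also have "\<dots> = (\<Sum>(b, c)\<in>?E. run_poly G b u st * t b c)"
    unfolding sum.distrib[symmetric]
    by (intro sum.cong) (auto simp: run_poly_rec[OF less(1)] distrib_right)
  finally show ?case
    by (simp add: t_def mult.assoc)
qed

lemma is_path_last_in_closed:
  assumes "\<And>x y. x \<in> D \<Longrightarrow> (x, y) \<in> edges G \<Longrightarrow> y \<in> D"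
  shows "is_path G vs \<Longrightarrow> hd vs \<in> D \<Longrightarrow> last vs \<in> D"
proof (induction vs rule: induct_list012)
  case (3 x y zs)
  thus ?case using assms[of x y] by (simp add: is_path_Cons_Cons)
qed (simp_all add: is_path_def)

text \<open>No path leaves a successor-closed set, so the sum is empty. This disposes of popping
  edges whose tail is not among the vertices already treated.\<close>

lemma run_poly_outside_closed:
  assumes "\<And>x y. x \<in> D \<Longrightarrow> (x, y) \<in> edges G \<Longrightarrow> y \<in> D" "u \<in> D" "v \<notin> D"
  shows "run_poly G v u st = 0"
proof -
  have "last vs \<in> D" if "is_path G vs" "hd vs \<in> D" for vs
    using is_path_last_in_closed[OF _ that] assms(1) by blast
  hence "run_paths G v u st = {}"
    using assms(2,3) by (auto simp: run_paths_def)
  thus ?thesis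
    by (simp add: run_poly_def)
qed

section \<open>Evaluating the run polynomials vertex by vertex\<close>

abbreviation reach_polys :: "'v set \<Rightarrow> 'a mpoly set" where
  "reach_polys D \<equiv> (\<lambda>(u, v). run_poly G v u []) ` (D \<times> verts G)"

text \<open>With \<open>m\<close> vertices there are at most \<open>m * m\<close> popping edges, so
  the term of one successor costs at most \<open>4 + 4 * (m * m)\<close>, and one addition follows.
  The 3 covers the initial 0 or 1 of the recursion, the empty sum and the final addition. Constants
  are rounded up.\<close>

definition vertex_cost :: nat where
  "vertex_cost = 3 + card (verts G) * (6 + 4 * (card (verts G) * card (verts G)))"

text \<open>A push leads to a run with stack \<open>[s]\<close>, which \<open>run_poly_snoc\<close>
  splits into products of runs with empty stack. The first factor starts in \<open>D\<close>, and so
  does the second unless the first is 0.\<close>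

lemma slp_computes_run_poly:
  assumes u: "u \<in> verts G" and v: "v \<in> verts G" and D: "D \<subseteq> verts G"
    and closed: "\<And>x y. x \<in> D \<Longrightarrow> (x, y) \<in> edges G \<Longrightarrow> y \<in> D"
    and succs: "edges G `` {u} \<subseteq> D"
  shows "slp_computes (reach_polys D) vertex_cost {run_poly G v u []}"
proof -
  let ?m = "card (verts G)"
  let ?A = "reach_polys D"
  have mem: "slp_computes ?A 0 {run_poly G c b []}" if "b \<in> D" "c \<in> verts G" for b c
    by (rule slp_computes_subset) (use that in auto)
  have step: "slp_computes ?A (4 + 4 * (?m * ?m)) {step_poly v u [] x}" if x: "x \<in> D" for x
  proof (cases "stack_op G (u, x)")
    case Nop
    have "slp_computes ?A (Suc (Suc 0 + 0)) {label_poly (weight G (u, x)) * run_poly G v x []}"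
      by (intro slp_computes_mult slp_computes_label mem x v)
    thus ?thesis
      by (rule slp_computes_mono) (auto simp: step_poly_def Nop)
  next
    case (Pop s)
    show ?thesis
      by (rule slp_computes_mono[OF slp_computes_0]) (auto simp: step_poly_def Pop)
  next
    case (Push s)
    let ?E = "{e \<in> edges G. stack_op G e = Pop s}"
    have "slp_computes ?A 3
        {run_poly G b x [] * label_poly (weight G (b, c)) * run_poly G v c []}"
      if bc: "(b, c) \<in> ?E" for b c
    proof (cases "b \<in> D")
      case True
      hence "b \<in> verts G" "c \<in> D"
        using D closed bc by auto
      hence "slp_computes ?A (Suc (Suc (0 + Suc 0) + 0))
          {run_poly G b x [] * label_poly (weight G (b, c)) * run_poly G v c []}"
        by (intro slp_computes_mult slp_computes_label mem x v)
      thus ?thesis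
        by (rule slp_computes_mono) auto
    next
      case False
      hence "run_poly G b x [] = 0"
        by (intro run_poly_outside_closed[of D, OF closed x])
      thus ?thesis
        by (intro slp_computes_mono[OF slp_computes_0]) auto
    qed
    hence "slp_computes ?A (Suc (card ?E * Suc 3)) {\<Sum>e\<in>?E.
        run_poly G (fst e) x [] * label_poly (weight G (fst e, snd e)) * run_poly G v (snd e) []}"
      by (intro slp_computes_sum) (use finite_edges in auto)
    hence "slp_computes ?A (Suc (card ?E * Suc 3)) {run_poly G v x ([] @ [s])}"
      using x D by (subst run_poly_snoc) (auto simp: case_prod_unfold)
    hence "slp_computes ?A (Suc (Suc 0 + Suc (card ?E * Suc 3)))
        {label_poly (weight G (u, x)) * run_poly G v x ([] @ [s])}"
      by (intro slp_computes_mult slp_computes_label)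
    moreover have "card ?E \<le> ?m * ?m"
      using card_mono[OF finite_edges, of ?E] card_edges by auto
    ultimately show ?thesis
      by (elim slp_computes_mono) (auto simp: step_poly_def Push)
  qed
  have "slp_computes ?A (Suc (card (edges G `` {u}) * Suc (4 + 4 * (?m * ?m))))
      {\<Sum>x\<in>edges G `` {u}. step_poly v u [] x}"
    by (intro slp_computes_sum finite_succs step) (use succs in auto)
  moreover have "slp_computes ?A (Suc 0) {if u = v then 1 else 0}"
    by (simp add: slp_computes_0 slp_computes_1)
  ultimately have "slp_computes ?A
      (Suc (Suc 0 + Suc (card (edges G `` {u}) * Suc (4 + 4 * (?m * ?m)))))
      {(if u = v then 1 else 0) + (\<Sum>x\<in>edges G `` {u}. step_poly v u [] x)}"
    by (intro slp_computes_add)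
  hence "slp_computes ?A (Suc (Suc 0 + Suc (card (edges G `` {u}) * Suc (4 + 4 * (?m * ?m)))))
      {run_poly G v u []}"
    by (simp add: run_poly_rec[OF u])
  moreover have "card (edges G `` {u}) * Suc (4 + 4 * (?m * ?m)) \<le> ?m * (6 + 4 * (?m * ?m))"
    by (intro mult_le_mono card_succs) simp
  ultimately show ?thesis
    by (elim slp_computes_mono) (auto simp: vertex_cost_def)
qed

text \<open>Removing from \<open>D\<close> a vertex \<open>u\<close> without predecessors in
  \<open>D\<close> leaves a closed set that contains all successors of \<open>u\<close>; one more
  round of \<open>card (verts G)\<close> polynomials then handles \<open>u\<close>.\<close>

lemma slp_computes_reach_polys:
  assumes "D \<subseteq> verts G" "\<And>x y. x \<in> D \<Longrightarrow> (x, y) \<in> edges G \<Longrightarrow> y \<in> D"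
  shows "slp_computes {} (card D * (card (verts G) * vertex_cost)) (reach_polys D)"
  using assms
proof (induction "card D" arbitrary: D)
  case 0
  hence "D = {}"
    using finite_subset[OF _ finite_verts] by simp
  thus ?case by (simp add: slp_computes_subset)
next
  case (Suc n)
  have fin: "finite D"
    using Suc(3) finite_verts by (rule finite_subset)
  have "D \<noteq> {}"
    using Suc(2) by auto
  then obtain u where u: "u \<in> D" "\<And>x. (x, u) \<in> edges G \<Longrightarrow> x \<notin> D"
    using finite_acyclic_wf[OF finite_edges acyclic_edges] by (metis wf_eq_minimal ex_in_conv)
  let ?D = "D - {u}"
  have closed: "y \<in> ?D" if "x \<in> ?D" "(x, y) \<in> edges G" for x y
    using that u(2) Suc(4) by blast
  have succs: "edges G `` {u} \<subseteq> ?D"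
    using u(1,2) Suc(4) by blast
  have n: "n = card ?D"
    using Suc(2) u(1) fin by simp
  have IH: "slp_computes {} (n * (card (verts G) * vertex_cost)) (reach_polys ?D)"
    unfolding n by (rule Suc(1)[OF n _ closed]) (use Suc(3) in blast)+
  have "slp_computes (reach_polys ?D) (card (verts G) * vertex_cost)
      (\<Union>v\<in>verts G. {run_poly G v u []})"
    by (intro slp_computes_UNION finite_verts slp_computes_run_poly[OF _ _ _ closed succs])
      (use u(1) Suc(3) in blast)+
  with IH have "slp_computes {} (n * (card (verts G) * vertex_cost) + card (verts G) * vertex_cost)
      (reach_polys ?D \<union> (\<Union>v\<in>verts G. {run_poly G v u []}))"
    by (intro slp_computes_trans) simp_all
  thus ?case
    by (rule slp_computes_mono) (auto simp: Suc(2)[symmetric])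
qed

lemma slp_computes_sbp_poly:
  "slp_computes {} (card (verts G) * (card (verts G) * vertex_cost)) {sbp_poly G}"
proof (rule slp_computes_mono)
  show "slp_computes {} (card (verts G) * (card (verts G) * vertex_cost)) (reach_polys (verts G))"
    by (rule slp_computes_reach_polys) (use edges_subset in blast)+
  show "{sbp_poly G} \<subseteq> reach_polys (verts G)"
    using source_in_verts target_in_verts by (auto simp: sbp_poly_eq_run_poly)
qed simp_all

end


lemma VP_if_sbp:
  fixes f :: "nat \<Rightarrow> 'a::field mpoly" and G :: "nat \<Rightarrow> ('a, 'v, 's) sbp"
  assumes G: "\<And>n. stack_branching_program (G n)" "\<And>n. sbp_computes (G n) (f n)"
    "\<And>n. sbp_size (G n) \<le> poly p n"
  shows "f \<in> VP"
proof -
  \<comment> \<open>\<open>b m\<close> is the cost in \<open>slp_computes_sbp_poly\<close> for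
    \<open>m\<close> vertices, and \<open>q\<close> is the same expression with \<open>p\<close>
    substituted; monotonicity of \<open>b\<close> links the two.\<close>
  define b where "b m = m * (m * (3 + m * (6 + 4 * (m * m))))" for m :: nat
  define q where "q = p * (p * ([:3:] + p * ([:6:] + [:4:] * (p * p))))"
  have deg: "total_degree (f n) \<le> poly p n" for n
  proof -
    interpret stack_bp "G n"
      by standard (rule G)
    show ?thesis
      using total_degree_sbp_poly G(2)[of n] G(3)[of n] by (simp add: sbp_computes_def sbp_size_def)
  qed
  have "\<exists>C :: ('a, nat) circuit.
      arith_circuit C \<and> circuit_computes C (f n) \<and> circuit_size C \<le> poly q n" for n
  proof (rule circuit_of_slp)
    interpret stack_bp "G n"
      by standard (rule G)
    have "slp_computes {} (b (card (verts (G n)))) {f n}"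
      using slp_computes_sbp_poly G(2)[of n] by (simp add: b_def vertex_cost_def sbp_computes_def)
    moreover have "b (card (verts (G n))) \<le> b (poly p n)"
      using G(3)[of n] by (auto simp: b_def sbp_size_def intro!: mult_le_mono add_mono)
    moreover have "b (poly p n) = poly q n"
      by (simp add: b_def q_def)
    ultimately show "slp_computes {} (poly q n) {f n}"
      by (elim slp_computes_mono) auto
  qed
  thus ?thesis
    unfolding VP_def using deg by (intro CollectI conjI) (blast, metis)
qed

subsection \<open>Renaming vertices and stack symbols\<close>

text \<open>Only the comparison in a pop is sensitive to renaming, and injectivity on
  \<open>S\<close> preserves it.\<close>

lemma exec_op_map:
  assumes "inj_on \<psi> S" "set st \<subseteq> S" "symbols x \<subseteq> S"
  shows "exec_op (map_stack_op \<psi> x) (map \<psi> st) = map_option (map \<psi>) (exec_op x st)"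
  using assms by (cases x; cases st) (auto simp: inj_on_eq_iff)

lemma exec_op_set: "exec_op x st = Some st' \<Longrightarrow> set st' \<subseteq> set st \<union> symbols x"
  by (cases x; cases st) (auto split: if_splits)

text \<open>This moves the traversal program below, with its structured vertices and symbols, to
  natural numbers. The labellings matter only on edges, where \<open>inv_into\<close> recovers the
  original endpoints.\<close>

definition rename_sbp ::
  "('v \<Rightarrow> 'w) \<Rightarrow> ('s \<Rightarrow> 't) \<Rightarrow> ('a, 'v, 's) sbp \<Rightarrow> ('a, 'w, 't) sbp" where
  "rename_sbp \<phi> \<psi> G =
     (let \<phi>' = inv_into (verts G) \<phi> in
      \<lparr>verts = \<phi> ` verts G, edges = map_prod \<phi> \<phi> ` edges G,
       source = \<phi> (source G), target = \<phi> (target G),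
       weight = weight G \<circ> map_prod \<phi>' \<phi>', alphabet = \<psi> ` alphabet G,
       stack_op = map_stack_op \<psi> \<circ> stack_op G \<circ> map_prod \<phi>' \<phi>'\<rparr>)"

context stack_bp
begin

context
  fixes \<phi> :: "'v \<Rightarrow> 'w" and \<psi> :: "'s \<Rightarrow> 't"
  assumes inj_\<phi>: "inj_on \<phi> (verts G)" and inj_\<psi>: "inj_on \<psi> (alphabet G)"
begin

lemma rename_edge:
  assumes "(u, x) \<in> edges G"
  shows "weight (rename_sbp \<phi> \<psi> G) (\<phi> u, \<phi> x) = weight G (u, x)"
    and "stack_op (rename_sbp \<phi> \<psi> G) (\<phi> u, \<phi> x) = map_stack_op \<psi> (stack_op G (u, x))"
  using assms edges_subset by (auto simp: rename_sbp_def Let_def inv_into_f_f[OF inj_\<phi>])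

lemma symbols_edge: "e \<in> edges G \<Longrightarrow> symbols (stack_op G e) \<subseteq> alphabet G"
  using sbp by (auto simp: stack_branching_program_def)

lemma stack_branching_program_rename: "stack_branching_program (rename_sbp \<phi> \<psi> G)"
proof -
  let ?G = "rename_sbp \<phi> \<psi> G"
  \<comment> \<open>Renaming back maps the new edges into the old ones, so acyclicity is inherited
    through well-foundedness.\<close>
  have "wf (inv_image (edges G) (inv_into (verts G) \<phi>))"
    by (intro wf_inv_image finite_acyclic_wf finite_edges acyclic_edges)
  moreover have "edges ?G \<subseteq> inv_image (edges G) (inv_into (verts G) \<phi>)"
    using edges_subset by (auto simp: rename_sbp_def Let_def inv_into_f_f[OF inj_\<phi>])
  ultimately have "acyclic (edges ?G)"
    using wf_subset wf_acyclic by blast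
  moreover have "symbols (stack_op ?G e) \<subseteq> alphabet ?G" if e: "e \<in> edges ?G" for e
  proof -
    obtain u x where ux: "(u, x) \<in> edges G" "e = (\<phi> u, \<phi> x)"
      using e by (auto simp: rename_sbp_def Let_def)
    have "symbols (stack_op ?G e) = \<psi> ` symbols (stack_op G (u, x))"
      by (simp add: ux(2) rename_edge[OF ux(1)] stack_op.set_map)
    thus ?thesis
      using symbols_edge[OF ux(1)] by (auto simp: rename_sbp_def Let_def)
  qed
  ultimately show ?thesis
    using sbp edges_subset by (auto simp: stack_branching_program_def rename_sbp_def Let_def)
qed

text \<open>Both sides satisfy the same one-step recursion, and every edge keeps the stack within
  the alphabet, so injectivity there is enough.\<close>

lemma run_poly_rename:
  assumes "u \<in> verts G" "v \<in> verts G" "set st \<subseteq> alphabet G"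
  shows "run_poly (rename_sbp \<phi> \<psi> G) (\<phi> v) (\<phi> u) (map \<psi> st) = run_poly G v u st"
  using assms(1,3)
proof (induction u arbitrary: st rule: vertex_induct)
  case (less u)
  let ?G = "rename_sbp \<phi> \<psi> G"
  interpret R: stack_bp ?G
    by standard (rule stack_branching_program_rename)
  have "\<phi> u \<in> verts ?G"
    using less(1) by (simp add: rename_sbp_def Let_def)
  note rec = R.run_poly_rec[OF this]
  have succs: "edges ?G `` {\<phi> u} = \<phi> ` (edges G `` {u})"
    using edges_subset less(1) inj_\<phi>
    by (force simp: rename_sbp_def Let_def inj_on_eq_iff)
  have "inj_on \<phi> (edges G `` {u})"
    by (rule inj_on_subset[OF inj_\<phi>]) (use edges_subset in auto)
  moreover have "R.step_poly (\<phi> v) (\<phi> u) (map \<psi> st) (\<phi> x) = step_poly v u st x"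
    if x: "x \<in> edges G `` {u}" for x
  proof -
    have e: "(u, x) \<in> edges G"
      using x by simp
    note op = exec_op_map[OF inj_\<psi> less(3) symbols_edge[OF e]]
    show ?thesis
    proof (cases "exec_op (stack_op G (u, x)) st")
      case None
      thus ?thesis
        by (simp add: R.step_poly_def step_poly_def rename_edge[OF e] op)
    next
      case (Some st')
      have "set st' \<subseteq> alphabet G"
        using exec_op_set[OF Some] less(3) symbols_edge[OF e] by auto
      thus ?thesis
        using less(2)[OF e, of st']
        by (simp add: R.step_poly_def step_poly_def rename_edge[OF e] op Some)
    qed
  qed
  moreover have "\<phi> u = \<phi> v \<longleftrightarrow> u = v"
    using inj_\<phi> less(1) assms(2) by (simp add: inj_on_eq_iff)
  ultimately show ?case
    by (simp add: rec run_poly_rec[OF less(1)] succs sum.reindex)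
qed

lemma sbp_poly_rename: "sbp_poly (rename_sbp \<phi> \<psi> G) = sbp_poly G"
proof -
  interpret R: stack_bp "rename_sbp \<phi> \<psi> G"
    by standard (rule stack_branching_program_rename)
  have "source (rename_sbp \<phi> \<psi> G) = \<phi> (source G)" "target (rename_sbp \<phi> \<psi> G) = \<phi> (target G)"
    by (simp_all add: rename_sbp_def Let_def)
  thus ?thesis
    using run_poly_rename[OF source_in_verts target_in_verts, of "[]"]
    by (simp add: sbp_poly_eq_run_poly R.sbp_poly_eq_run_poly)
qed

lemma sbp_size_rename: "sbp_size (rename_sbp \<phi> \<psi> G) = sbp_size G"
  by (simp add: sbp_size_def rename_sbp_def Let_def card_image[OF inj_\<phi>])

end

lemma nat_sbp:
  "\<exists>H :: ('a, nat, nat) sbp. stack_branching_program H \<and> sbp_poly H = sbp_poly G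
     \<and> sbp_size H = sbp_size G"
proof -
  have "finite (alphabet G)"
    using sbp by (simp add: stack_branching_program_def)
  with finite_verts obtain \<phi> :: "'v \<Rightarrow> nat" and \<psi> :: "'s \<Rightarrow> nat"
    where "inj_on \<phi> (verts G)" "inj_on \<psi> (alphabet G)"
    by (meson finite_imp_inj_to_nat_seg)
  thus ?thesis
    using stack_branching_program_rename sbp_poly_rename sbp_size_rename by blast
qed

end

subsection \<open>A stack branching program traversing the homogenized circuit\<close>

text \<open>
  \<open>Call k g i\<close> is the entry to the traversal of the degree \<open>i\<close> component of gate \<open>g\<close> after
  \<open>k\<close> variables have been read; \<open>Ret k\<close> is the exit of every traversal ending with \<open>k\<close>
  variables read. A stack symbol \<open>(g, i)\<close> is a pending call.
\<close>

datatype 'g vertex = Src | Call nat 'g nat | Ret nat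

locale circuit_sbp =
  fixes C :: "('a::comm_semiring_1, 'g) circuit" and d :: nat
  assumes circuit: "arith_circuit C"
begin

definition val :: "'g \<Rightarrow> 'a mpoly" where
  "val g = (THE p. gate_computes C g p)"

definition const_coeff :: "'g \<Rightarrow> 'a" where
  "const_coeff g = Poly_Mapping.lookup (val g) 0"

lemma val_eq: "gate_computes C g p \<Longrightarrow> val g = p"
  unfolding val_def by (rule the_equality) (auto dest: gate_computes_unique)

lemma gate_computes_val: "g \<in> gates C \<Longrightarrow> gate_computes C g (val g)"
  using gate_computes_exists[OF circuit] val_eq by blast

lemma operand_in_gates: "g \<in> gates C \<Longrightarrow> h \<in> operands (kind C g) \<Longrightarrow> h \<in> gates C"
  using circuit by (auto simp: arith_circuit_def)

lemma finite_gates: "finite (gates C)"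
  using circuit by (simp add: arith_circuit_def)

lemma output_in_gates: "output_gate C \<in> gates C"
  using circuit by (auto simp: arith_circuit_def)

lemma wf_wires: "wf (wires C)"
proof (rule finite_acyclic_wf)
  show "finite (wires C)"
    by (rule finite_subset[of _ "gates C \<times> gates C"])
      (use finite_gates operand_in_gates in \<open>auto simp: wires_def\<close>)
  show "acyclic (wires C)"
    using circuit by (simp add: arith_circuit_def)
qed

lemma val_Input: "kind C g = Input l \<Longrightarrow> val g = label_poly l"
  by (rule val_eq) (rule gate_computes.input)

lemma val_Plus: "g \<in> gates C \<Longrightarrow> kind C g = Plus a b \<Longrightarrow> val g = val a + val b"
  using operand_in_gates[of g] by (intro val_eq gate_computes.plus) (auto intro: gate_computes_val)

lemma val_Times: "g \<in> gates C \<Longrightarrow> kind C g = Times a b \<Longrightarrow> val g = val a * val b"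
  using operand_in_gates[of g] by (intro val_eq gate_computes.times) (auto intro: gate_computes_val)

text \<open>The two terms are added since a gate may use the same operand twice.\<close>

definition nop_coeff :: "'g \<Rightarrow> 'g \<Rightarrow> 'a" where
  "nop_coeff g h = (case kind C g of
       Input l \<Rightarrow> 0
     | Plus a b \<Rightarrow> (if h = a then 1 else 0) + (if h = b then 1 else 0)
     | Times a b \<Rightarrow> (if h = a then const_coeff b else 0) + (if h = b then const_coeff a else 0))"

text \<open>Calls from \<open>Src\<close> start at \<open>d - i\<close> so that all of them return
  at \<open>Ret d\<close>; the component of degree 0 uses the direct edge. A product of degree
  \<open>i\<close> has operand degrees \<open>(i, 0)\<close> or \<open>(0, i)\<close>, where the
  scalar becomes a weight, or \<open>(j, i - j)\<close> with \<open>1 \<le> j < i\<close>, where the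
  second call is pushed. Constants have no component of positive degree, hence no successor.\<close>

fun succs :: "'g vertex \<Rightarrow> 'g vertex set" where
  "succs Src = insert (Ret d) ((\<lambda>i. Call (d - i) (output_gate C) i) ` {1..d})"
| "succs (Ret k) = (\<lambda>(g, i). Call k g i) ` (gates C \<times> {1..d - k})"
| "succs (Call k g i) = (case kind C g of
       Input (Const c) \<Rightarrow> {}
     | Input (Var x) \<Rightarrow> (if i = 1 then {Ret (k + 1)} else {})
     | Plus a b \<Rightarrow> (\<lambda>h. Call k h i) ` {a, b}
     | Times a b \<Rightarrow> (\<lambda>h. Call k h i) ` {a, b} \<union> (\<lambda>j. Call k a j) ` {1..<i})"

text \<open>Between calls, equal degrees mark the edges that carry a scalar, and a smaller degree
  marks a push. An edge from a call to a return exists only at a variable, which is read there;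
  \<open>Const 0\<close> is a filler.\<close>

fun edge_weight :: "'g vertex \<times> 'g vertex \<Rightarrow> 'a label" where
  "edge_weight (Src, Ret k) = Const (const_coeff (output_gate C))"
| "edge_weight (Call k g i, Ret k') = (case kind C g of Input l \<Rightarrow> l | _ \<Rightarrow> Const 0)"
| "edge_weight (Call k g i, Call k' h j) = Const (if j = i then nop_coeff g h else 1)"
| "edge_weight _ = Const 1"

fun edge_op :: "'g vertex \<times> 'g vertex \<Rightarrow> ('g \<times> nat) stack_op" where
  "edge_op (Call k g i, Call k' h j) =
     (if j < i then case kind C g of Times a b \<Rightarrow> Push (b, i - j) | _ \<Rightarrow> Nop else Nop)"
| "edge_op (Ret k, Call k' g i) = Pop (g, i)"
| "edge_op _ = Nop"

text \<open>The bound \<open>k + i \<le> d\<close> keeps the return point \<open>Ret (k + i)\<close>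
  of each call among the vertices.\<close>

definition vertices :: "'g vertex set" where
  "vertices = insert Src (Ret ` {..d} \<union> {Call k g i |k g i. g \<in> gates C \<and> 1 \<le> i \<and> k + i \<le> d})"

definition bp :: "('a, 'g vertex, 'g \<times> nat) sbp" where
  "bp = \<lparr>verts = vertices, edges = {(u, v). u \<in> vertices \<and> v \<in> succs u},
         source = Src, target = Ret d, weight = edge_weight,
         alphabet = gates C \<times> {1..d}, stack_op = edge_op\<rparr>"

section \<open>Size and acyclicity of the traversal program\<close>

lemma vertices_subset:
  "vertices \<subseteq> insert Src (Ret ` {..d} \<union> (\<lambda>(k, g, i). Call k g i) ` ({..d} \<times> gates C \<times> {..d}))"
  (is "_ \<subseteq> insert Src (?R \<union> ?C)")
proof -
  have "Call k g i \<in> ?C" if "g \<in> gates C" "k + i \<le> d" for k g i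
    by (rule rev_image_eqI[of "(k, g, i)"]) (use that in auto)
  thus ?thesis
    by (auto simp: vertices_def)
qed

lemma finite_vertices: "finite vertices"
  by (rule finite_subset[OF vertices_subset]) (simp add: finite_gates)

lemma sbp_size_bp: "sbp_size bp \<le> 1 + ((d + 1) + (d + 1) * ((d + 1) * circuit_size C))"
proof -
  let ?R = "Ret ` {..d} :: 'g vertex set"
  let ?C = "(\<lambda>(k, g, i). Call k g i) ` ({..d} \<times> gates C \<times> {..d})"
  have "card vertices \<le> card (insert Src (?R \<union> ?C))"
    by (rule card_mono[OF _ vertices_subset]) (simp add: finite_gates)
  also have "\<dots> \<le> Suc (card (?R \<union> ?C))"
    by (subst card_insert_if) (simp_all add: finite_gates)
  also have "card (?R \<union> ?C) \<le> card ?R + card ?C"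
    by (rule card_Un_le)
  also have "card ?R \<le> d + 1"
    using card_image_le[of "{..d}" Ret] by simp
  also have "card ?C \<le> (d + 1) * (circuit_size C * (d + 1))"
    using card_image_le[of "{..d} \<times> gates C \<times> {..d}" "\<lambda>(k, g, i). Call k g i"]
    by (simp add: finite_gates card_cartesian_product circuit_size_def)
  finally show ?thesis
    by (simp add: sbp_size_def bp_def ac_simps)
qed

lemma succs_subset: "u \<in> vertices \<Longrightarrow> succs u \<subseteq> vertices"
  using output_in_gates operand_in_gates[of "case u of Call k g i \<Rightarrow> g"]
  by (cases u) (auto simp: vertices_def split: gate.splits label.splits)

lemma acyclic_succs: "acyclic {(u, v). u \<in> vertices \<and> v \<in> succs u}"
proof -
  \<comment> \<open>Every edge lowers this key lexicographically: calling an operand keeps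
    \<open>k\<close> and descends along a wire, and reading a variable raises \<open>k\<close>. The
    extra 1 places \<open>Ret k\<close> above the calls at the same \<open>k\<close> and below those
    at smaller \<open>k\<close>; \<open>Src\<close> lies above everything.\<close>
  define key where "key u = (case u of
      Src \<Rightarrow> (2 * d + 4, output_gate C)
    | Call k g i \<Rightarrow> (2 * (d + 1 - k), g)
    | Ret k \<Rightarrow> (2 * (d + 1 - k) + 1, output_gate C))" for u :: "'g vertex"
  have "(key v, key u) \<in> less_than <*lex*> wires C" if "u \<in> vertices" "v \<in> succs u" for u v
    using that
    by (cases u) (auto simp: key_def vertices_def wires_def split: gate.splits label.splits if_splits)
  hence "({(u, v). u \<in> vertices \<and> v \<in> succs u})\<inverse> \<subseteq> inv_image (less_than <*lex*> wires C) key"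
    by auto
  moreover have "wf (inv_image (less_than <*lex*> wires C) key)"
    by (intro wf_inv_image wf_lex_prod wf_less_than wf_wires)
  ultimately show ?thesis
    using wf_subset wf_acyclic acyclic_converse by blast
qed

lemma symbols_edge_op:
  "u \<in> vertices \<Longrightarrow> v \<in> succs u \<Longrightarrow> symbols (edge_op (u, v)) \<subseteq> gates C \<times> {1..d}"
  using operand_in_gates[of "case u of Call k g i \<Rightarrow> g"]
  by (cases u; cases v) (auto simp: vertices_def split: gate.splits label.splits)

lemma stack_branching_program_bp: "stack_branching_program bp"
  using finite_vertices succs_subset acyclic_succs symbols_edge_op finite_gates
  by (auto simp: stack_branching_program_def bp_def) (auto simp: vertices_def)

sublocale stack_bp bp
  by standard (rule stack_branching_program_bp)

section \<open>Correctness of the traversal\<close>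

abbreviation run :: "'g vertex \<Rightarrow> ('g \<times> nat) list \<Rightarrow> 'a mpoly" where
  "run \<equiv> run_poly bp (Ret d)"

abbreviation step :: "'g vertex \<Rightarrow> ('g \<times> nat) list \<Rightarrow> 'g vertex \<Rightarrow> 'a mpoly" where
  "step \<equiv> step_poly (Ret d)"

lemma run_rec:
  "u \<in> vertices \<Longrightarrow>
   run u st = (if u = Ret d \<and> st = [] then 1 else 0) + (\<Sum>x\<in>succs u. step u st x)"
proof -
  assume u: "u \<in> vertices"
  have "edges bp `` {u} = succs u"
    using u by (auto simp: bp_def)
  thus ?thesis
    using u run_poly_rec[of u "Ret d" st] by (simp add: bp_def)
qed

lemma step_eq: "step u st x = label_poly (edge_weight (u, x)) *
     (case exec_op (edge_op (u, x)) st of None \<Rightarrow> 0 | Some st' \<Rightarrow> run x st')"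
  unfolding step_poly_def by (simp add: bp_def)

lemma finite_succs': "finite (succs u)"
  by (cases u) (auto simp: finite_gates split: gate.splits label.splits)

lemma run_Ret_Nil: "run (Ret d) [] = 1"
  by (subst run_rec) (simp_all add: vertices_def)

text \<open>Among the edges out of \<open>Ret k\<close>, all are blocked except the one that pops
  the top symbol, which enters the pending call.\<close>

lemma run_Ret_Cons:
  assumes "g \<in> gates C" "1 \<le> i" "k + i \<le> d"
  shows "run (Ret k) ((g, i) # st) = run (Call k g i) st"
proof -
  have "run (Ret k) ((g, i) # st) = (\<Sum>x\<in>succs (Ret k). step (Ret k) ((g, i) # st) x)"
    using assms by (subst run_rec) (auto simp: vertices_def)
  also have "\<dots> = (\<Sum>x\<in>succs (Ret k). if x = Call k g i then run x st else 0)"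
    by (intro sum.cong) (auto simp: step_eq split: if_splits)
  also have "\<dots> = run (Call k g i) st"
    using assms by (subst sum.delta[OF finite_succs']) auto
  finally show ?thesis .
qed

text \<open>If \<open>a = b\<close>, the set is a singleton whose coefficient is the sum of both;
  otherwise one conditional vanishes at each element.\<close>

lemma sum_pair_coeff:
  "(\<Sum>h\<in>{a, b}. Poly_Mapping.single 0 ((if h = a then \<alpha> else 0) + (if h = b then \<beta> else 0)) * F h)
     = Poly_Mapping.single 0 \<alpha> * F a + Poly_Mapping.single 0 \<beta> * (F b :: 'a mpoly)"
  by (cases "a = b") (simp_all add: single_add distrib_right)

text \<open>The central invariant: a traversal contributes its component as a factor and returns
  with the stack unchanged. \<open>k\<close>, \<open>i\<close> and \<open>st\<close> vary in the
  induction because the first factor of a product is traversed above a pushed symbol and the second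
  from a larger \<open>k\<close>.\<close>

lemma run_Call:
  assumes "g \<in> gates C" "1 \<le> i" "k + i \<le> d"
  shows "run (Call k g i) st = hom_component i (val g) * run (Ret (k + i)) st"
  using wf_wires assms
proof (induction g arbitrary: k i st rule: wf_induct_rule)
  case (less g)
  have operand: "run (Call k' h i') st' = hom_component i' (val h) * run (Ret (k' + i')) st'"
    if "h \<in> operands (kind C g)" "1 \<le> i'" "k' + i' \<le> d" for h k' i' st'
    using less that operand_in_gates[OF less(2)] by (auto simp: wires_def)
  have rec: "run (Call k g i) st = (\<Sum>x\<in>succs (Call k g i). step (Call k g i) st x)"
    using less by (subst run_rec) (auto simp: vertices_def)
  let ?R = "run (Ret (k + i)) st"
  have nop: "(\<Sum>x\<in>(\<lambda>h. Call k h i) ` operands (kind C g). step (Call k g i) st x) =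
      (\<Sum>h\<in>operands (kind C g). Poly_Mapping.single 0 (nop_coeff g h)
          * (hom_component i (val h) * ?R))"
    using less by (subst sum.reindex) (auto simp: inj_on_def step_eq operand intro!: sum.cong)
  show ?case
  proof (cases "kind C g")
    case (Input l)
    show ?thesis
    proof (cases l)
      case (Const c)
      thus ?thesis
        using less(3) by (simp add: rec Input val_Input hom_component_single)
    next
      case (Var x)
      thus ?thesis
        by (simp add: rec Input val_Input hom_component_single step_eq)
    qed
  next
    case (Plus a b)
    have "run (Call k g i) st = (\<Sum>h\<in>{a, b}. Poly_Mapping.single 0 (nop_coeff g h)
          * (hom_component i (val h) * ?R))"
      using nop by (simp add: rec Plus)
    also have "\<dots> = hom_component i (val a) * ?R + hom_component i (val b) * ?R"
      by (simp add: nop_coeff_def Plus sum_pair_coeff del: sum.insert)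
    finally show ?thesis
      by (simp add: val_Plus[OF less(2) Plus] hom_component_add distrib_right)
  next
    case (Times a b)
    define N where "N = (\<lambda>h. Call k h i) ` {a, b}"
    define P where "P = (\<lambda>j. Call k a j) ` {1..<i}"
    have ab: "a \<in> operands (kind C g)" "b \<in> operands (kind C g)" "b \<in> gates C"
      using operand_in_gates[OF less(2), of b] by (auto simp: Times)
    have "run (Call k g i) st = (\<Sum>x\<in>N \<union> P. step (Call k g i) st x)"
      by (simp add: rec Times N_def P_def)
    also have "\<dots> = (\<Sum>x\<in>N. step (Call k g i) st x) + (\<Sum>x\<in>P. step (Call k g i) st x)"
      by (rule sum.union_disjoint) (auto simp: N_def P_def)
    also have "(\<Sum>x\<in>N. step (Call k g i) st x) =
        (\<Sum>h\<in>{a, b}. Poly_Mapping.single 0 (nop_coeff g h) * (hom_component i (val h) * ?R))"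
      unfolding N_def using nop by (simp add: Times)
    also have "\<dots> = hom_component 0 (val b) * (hom_component i (val a) * ?R)
        + hom_component 0 (val a) * (hom_component i (val b) * ?R)"
      by (simp add: nop_coeff_def Times sum_pair_coeff hom_component_0 const_coeff_def
          del: sum.insert)
    also have "(\<Sum>x\<in>P. step (Call k g i) st x) =
        (\<Sum>j\<in>{1..<i}. hom_component j (val a) * hom_component (i - j) (val b) * ?R)"
    proof -
      have "step (Call k g i) st (Call k a j) =
          hom_component j (val a) * hom_component (i - j) (val b) * ?R" if j: "j \<in> {1..<i}" for j
      proof -
        \<comment> \<open>The push starts the traversal of \<open>a\<close>; its return pops the
          pending call of \<open>b\<close>, which starts at \<open>k + j\<close> and returns at
          \<open>k + i\<close>.\<close>
        have "step (Call k g i) st (Call k a j) = run (Call k a j) ((b, i - j) # st)"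
          using j by (simp add: step_eq Times)
        also have "\<dots> = hom_component j (val a) * run (Ret (k + j)) ((b, i - j) # st)"
          using j less(4) by (intro operand ab) auto
        also have "run (Ret (k + j)) ((b, i - j) # st) = run (Call (k + j) b (i - j)) st"
          using j less(4) by (intro run_Ret_Cons ab) auto
        also have "\<dots> = hom_component (i - j) (val b) * run (Ret (k + j + (i - j))) st"
          using j less(4) by (intro operand ab) auto
        finally show ?thesis
          using j by (simp add: mult.assoc)
      qed
      thus ?thesis
        unfolding P_def by (subst sum.reindex) (auto simp: inj_on_def)
    qed
    also have "hom_component 0 (val b) * (hom_component i (val a) * ?R)
        + hom_component 0 (val a) * (hom_component i (val b) * ?R)
        + (\<Sum>j\<in>{1..<i}. hom_component j (val a) * hom_component (i - j) (val b) * ?R)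
        = hom_component i (val a * val b) * ?R"
    proof -
      \<comment> \<open>Since \<open>1 \<le> i\<close>, the indices 0 and \<open>i\<close> are
        distinct; they account for the two scalar terms.\<close>
      have "{..i} = insert 0 (insert i {1..<i})"
        using less(3) by auto
      thus ?thesis
        using less(3) by (simp add: hom_component_mult sum_distrib_left algebra_simps)
    qed
    finally show ?thesis
      by (simp add: val_Times[OF less(2) Times])
  qed
qed

text \<open>The edges out of \<open>Src\<close> contribute the components of degree 0 to
  \<open>d\<close> one by one, and the degree bound makes their sum \<open>f\<close>.\<close>

lemma sbp_poly_bp:
  assumes "circuit_computes C f" "total_degree f \<le> d"
  shows "sbp_poly bp = f"
proof -
  let ?out = "output_gate C"
  have f: "val ?out = f"
    using assms(1) val_eq by (simp add: circuit_computes_def)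
  have "sbp_poly bp = run Src []"
    unfolding sbp_poly_eq_run_poly by (simp add: bp_def)
  also have "\<dots> = (\<Sum>x\<in>succs Src. step Src [] x)"
    by (subst run_rec) (auto simp: vertices_def)
  also have "\<dots> = step Src [] (Ret d)
      + (\<Sum>x\<in>(\<lambda>i. Call (d - i) ?out i) ` {1..d}. step Src [] x)"
    by (simp only: succs.simps) (subst sum.insert, auto)
  also have "step Src [] (Ret d) = hom_component 0 f"
    by (simp add: step_eq run_Ret_Nil f const_coeff_def hom_component_0)
  also have "(\<Sum>x\<in>(\<lambda>i. Call (d - i) ?out i) ` {1..d}. step Src [] x) =
      (\<Sum>i\<in>{1..d}. step Src [] (Call (d - i) ?out i))"
    by (subst sum.reindex) (auto simp: inj_on_def)
  also have "\<dots> = (\<Sum>i\<in>{1..d}. hom_component i f)"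
    by (intro sum.cong) (auto simp: step_eq run_Call output_in_gates run_Ret_Nil f)
  also have "hom_component 0 f + \<dots> = (\<Sum>i\<le>d. hom_component i f)"
  proof -
    have "{..d} = insert 0 {1..d}"
      by auto
    thus ?thesis by simp
  qed
  also have "\<dots> = f"
    by (rule sum_hom_component[OF assms(2)])
  finally show ?thesis .
qed

end

lemma sbp_if_VP:
  fixes f :: "nat \<Rightarrow> 'a::field mpoly"
  assumes "f \<in> VP"
  shows "\<exists>(p :: nat poly) (G :: nat \<Rightarrow> ('a, nat, nat) sbp). \<forall>n.
    stack_branching_program (G n) \<and> sbp_computes (G n) (f n) \<and> sbp_size (G n) \<le> poly p n"
proof -
  from assms obtain d q :: "nat poly" and C :: "nat \<Rightarrow> ('a, nat) circuit"
    where d: "\<And>n. total_degree (f n) \<le> poly d n" and C: "\<And>n. arith_circuit (C n)"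
      "\<And>n. circuit_computes (C n) (f n)" "\<And>n. circuit_size (C n) \<le> poly q n"
    unfolding VP_def by blast
  define p where "p = 1 + ((d + 1) + (d + 1) * ((d + 1) * q))"
  have "\<exists>H :: ('a, nat, nat) sbp.
      stack_branching_program H \<and> sbp_computes H (f n) \<and> sbp_size H \<le> poly p n" for n
  proof -
    \<comment> \<open>The degree bound at \<open>n\<close> serves as the truncation degree, which
      keeps the size polynomial in \<open>n\<close>.\<close>
    interpret circuit_sbp "C n" "poly d n"
      by standard (rule C)
    have "sbp_size bp \<le> 1 + ((poly d n + 1) + (poly d n + 1) * ((poly d n + 1) * circuit_size (C n)))"
      by (rule sbp_size_bp)
    also have "\<dots> \<le> poly p n"
      unfolding p_def poly_add poly_mult poly_1 by (intro add_mono mult_le_mono C order.refl)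
    finally show ?thesis
      using nat_sbp sbp_poly_bp[OF C(2) d] by (auto simp: sbp_computes_def)
  qed
  thus ?thesis
    by metis
qed

theorem theorem9:
  fixes f :: "nat \<Rightarrow> 'a::field mpoly"
  shows "f \<in> VP \<longleftrightarrow>
    (\<exists>(p :: nat poly) (G :: nat \<Rightarrow> ('a, nat, nat) sbp). \<forall>n.
       stack_branching_program (G n) \<and> sbp_computes (G n) (f n) \<and> sbp_size (G n) \<le> poly p n)"
  using sbp_if_VP VP_if_sbp by blast

end
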